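(* Let $(X,d)$ be a finite ultrametric space with $|X|\ge2$. Then $X\in\mathfrak{R}$ if and only if the diametrical graph $G_B$ is a star for every ball $B\in\mathbf{B}_X$ with $\operatorname{diam}B>0$.
   Context: An ultrametric space is a metric space with $d(x,y)\le\max\{d(x,z),d(z,y)\}$ for all $x,y,z$. $\operatorname{Iso}(X)$ is the group of isometries of $(X,d)$ (bijective distance-preserving maps $X\to X$), and $\operatorname{Fix}(g)=\{x\in X: g(x)=x\}$. $\mathfrak{R}$ denotes the class of all finite ultrametric spaces $(X,d)$ with $\min_{g\in \operatorname{Iso}(X)}|\operatorname{Fix}(g)|=|X|-2$. A ball in $(X,d)$ is a set of the form $B_r(t)=\{x\in X: d(x,t)\le r\}$ with $t\in X$, $r\ge0$; $\mathbf{B}_X$ is the set of all balls. For a finite ultrametric space $W$ with $|W|\ge2$, the diametrical graph $G_W$ has vertex set $W$, and $u,v$ are adjacent iff their distance equals $\operatorname{diam}W$; balls carry the restricted metric. A star is a complete bipartite graph one of whose two parts has exactly one vertex. *)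

theory Defs
  imports "HOL-Analysis.Abstract_Metric_Spaces"
    "Graph_Theory.Kuratowski"
begin

locale Ultrametric_space = Metric_space +
  assumes ultrametric:
    "\<lbrakk>x \<in> M; y \<in> M; z \<in> M\<rbrakk> \<Longrightarrow> d x y \<le> max (d x z) (d z y)"

(* Isometries are taken in extensional form, so that each map X \<rightarrow> X
   is represented by exactly one HOL function. *)
definition Iso :: "'a set \<Rightarrow> ('a \<Rightarrow> 'a \<Rightarrow> real) \<Rightarrow> ('a \<Rightarrow> 'a) set" where
  "Iso X d = {g \<in> extensional X. bij_betw g X X \<and> (\<forall>x\<in>X. \<forall>y\<in>X. d (g x) (g y) = d x y)}"

definition Fix :: "'a set \<Rightarrow> ('a \<Rightarrow> 'a) \<Rightarrow> 'a set" where
  "Fix X g = {x \<in> X. g x = x}"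

(* The equation is stated over the integers because |X| - 2 may be negative. *)
definition class_R :: "('a set \<times> ('a \<Rightarrow> 'a \<Rightarrow> real)) set" where
  "class_R = {(X, d). Ultrametric_space X d \<and> finite X \<and>
     int (Min ((\<lambda>g. card (Fix X g)) ` Iso X d)) = int (card X) - 2}"

definition balls :: "'a set \<Rightarrow> ('a \<Rightarrow> 'a \<Rightarrow> real) \<Rightarrow> 'a set set" where
  "balls X d = {Metric_space.mcball X d t r | t r. t \<in> X \<and> 0 \<le> r}"

(* The analogue of the library's diameter, for a metric given as a function. *)
definition diam :: "'a set \<Rightarrow> ('a \<Rightarrow> 'a \<Rightarrow> real) \<Rightarrow> real" where
  "diam W d = (if W = {} then 0 else SUP (x, y) \<in> W \<times> W. d x y)"

(* Simple graphs are symmetric irreflexive pair digraphs: each edge {u, v} is the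
   pair of arcs (u, v) and (v, u). *)
definition diametrical_graph :: "'a set \<Rightarrow> ('a \<Rightarrow> 'a \<Rightarrow> real) \<Rightarrow> 'a pair_pre_digraph" where
  "diametrical_graph W d =
     \<lparr>pverts = W, parcs = {(u, v). u \<in> W \<and> v \<in> W \<and> u \<noteq> v \<and> d u v = diam W d}\<rparr>"

(* Both parts of a star are nonempty, so a single vertex is not a star. *)
definition is_star :: "'a pair_pre_digraph \<Rightarrow> bool" where
  "is_star G \<longleftrightarrow> (\<exists>n\<ge>1. complete_bipartite_digraph 1 n (with_proj G))"

end

theory Submission
  imports Defs "HOL-Combinatorics.Transposition"
begin

text \<open>Two points are twins if they have the same distance to every other point; then exchanging
  them is an isometry. A closest pair in a module (a set whose points have equal distances to
  each outside point) is a pair of twins, and two different pairs of twins compose to an isometry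
  that moves at least three points. If no isometry moves three points and \<open>a\<close> is one of the twins
  in a ball \<open>B\<close>, then the points of \<open>B\<close> at distance \<open>diam B\<close> from \<open>a\<close> form a module without
  \<open>a\<close>, so there is only one of them, and it is the centre of a star. Conversely, let an isometry \<open>g\<close> move
  the points of \<open>N\<close> and let \<open>B\<close> be the ball of diameter \<open>diam N\<close> around \<open>N\<close>. The centre \<open>p\<close> of
  its star belongs to \<open>N\<close>, because an edge of the star lies in \<open>N\<close>, and \<open>g\<close> sends every other point of
  \<open>B\<close> to \<open>p\<close>, because its image is at distance \<open>diam B\<close> from \<open>g p \<noteq> p\<close>. So \<open>B\<close> has two points.\<close>

section \<open>Diameters and stars in terms of distances\<close>

lemma
  assumes "finite W" "W \<noteq> {}"
  shows diam_ge: "\<And>x y. x \<in> W \<Longrightarrow> y \<in> W \<Longrightarrow> d x y \<le> diam W d"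
    and diam_attained: "\<exists>x\<in>W. \<exists>y\<in>W. d x y = diam W d"
proof -
  let ?S = "(\<lambda>(x, y). d x y) ` (W \<times> W)"
  have fin: "finite ?S" and ne: "?S \<noteq> {}"
    using assms by auto
  have eq: "diam W d = Max ?S"
    using assms cSup_eq_Max[OF fin ne] by (simp add: diam_def)
  show "d x y \<le> diam W d" if "x \<in> W" "y \<in> W" for x y
    unfolding eq using fin that by (intro Max_ge) auto
  show "\<exists>x\<in>W. \<exists>y\<in>W. d x y = diam W d"
    unfolding eq using Max_in[OF fin ne] by force
qed

text \<open>The one-point part becomes the centre \<open>p\<close>. The condition
  \<open>W \<noteq> {p}\<close> expresses that the other part is nonempty; symmetry of
  \<open>d\<close> supplies the arcs back to \<open>p\<close>.\<close>

lemma is_star_diametrical_graph_iff: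
  assumes "finite W" and sym: "\<And>x y. d x y = d y x"
  shows "is_star (diametrical_graph W d) \<longleftrightarrow>
    (\<exists>p\<in>W. W \<noteq> {p} \<and> (\<forall>v\<in>W - {p}. d p v = diam W d) \<and>
      (\<forall>u\<in>W - {p}. \<forall>v\<in>W - {p}. u \<noteq> v \<longrightarrow> d u v \<noteq> diam W d))"
    (is "?L \<longleftrightarrow> (\<exists>p\<in>W. ?P p)")
proof
  assume ?L
  then obtain n U V where n: "n \<ge> 1" and UV: "W = U \<union> V" "U \<inter> V = {}" "card U = 1" "card V = n"
    and E: "{(u, v). u \<in> W \<and> v \<in> W \<and> u \<noteq> v \<and> d u v = diam W d} = U \<times> V \<union> V \<times> U"
    unfolding is_star_def complete_bipartite_digraph_pair_def diametrical_graph_def by auto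
  obtain p where p: "U = {p}"
    using UV(3) by (auto simp: card_1_singleton_iff)
  have E': "u \<in> W \<and> v \<in> W \<and> u \<noteq> v \<and> d u v = diam W d \<longleftrightarrow> (u, v) \<in> U \<times> V \<union> V \<times> U" for u v
    unfolding E[symmetric] by simp
  have "V \<noteq> {}"
    using n UV by auto
  then have "W \<noteq> {p}"
    using UV p by auto
  moreover have "d p v = diam W d" if "v \<in> W - {p}" for v
    using E'[of p v] that UV(1) p by auto
  moreover have "d u v \<noteq> diam W d" if "u \<in> W - {p}" "v \<in> W - {p}" "u \<noteq> v" for u v
    using E'[of u v] that UV(1) p by auto
  ultimately show "\<exists>p\<in>W. ?P p"
    using UV(1) p by blast
next
  assume "\<exists>p\<in>W. ?P p"
  then obtain p where p: "p \<in> W" "W \<noteq> {p}" "\<And>v. v \<in> W - {p} \<Longrightarrow> d p v = diam W d"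
    "\<And>u v. u \<in> W - {p} \<Longrightarrow> v \<in> W - {p} \<Longrightarrow> u \<noteq> v \<Longrightarrow> d u v \<noteq> diam W d"
    by blast
  have "{(u, v). u \<in> W \<and> v \<in> W \<and> u \<noteq> v \<and> d u v = diam W d} =
      {p} \<times> (W - {p}) \<union> (W - {p}) \<times> {p}"
    (is "?E = ?F")
  proof (rule set_eqI)
    fix e show "e \<in> ?E \<longleftrightarrow> e \<in> ?F"
      using p(1) p(3)[of "fst e"] p(3)[of "snd e"] p(4)[of "fst e" "snd e"] sym[of "fst e" p]
      by (cases e; cases "fst e = p"; cases "snd e = p") auto
  qed
  moreover have "card (W - {p}) \<ge> 1"
    using p(1,2) \<open>finite W\<close> card_gt_0_iff[of "W - {p}"] by (auto simp del: card_Diff_insert)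
  moreover have "W = {p} \<union> (W - {p})" "{p} \<inter> (W - {p}) = {}" "card {p} = 1"
    using p(1) by auto
  ultimately show ?L
    unfolding is_star_def complete_bipartite_digraph_pair_def diametrical_graph_def
      pair_pre_digraph.simps using \<open>finite W\<close> by blast
qed

section \<open>Isometries, twins and moved points\<close>

lemma Fix_subset: "Fix X g \<subseteq> X"
  by (auto simp: Fix_def)

lemma Iso_id: "restrict id X \<in> Iso X d"
  by (auto simp: Iso_def bij_betw_def inj_on_def)

lemma Iso_compose: "f \<in> Iso X d \<Longrightarrow> g \<in> Iso X d \<Longrightarrow> compose X f g \<in> Iso X d"
  by (auto simp: Iso_def bij_betw_compose compose_eq bij_betw_apply)

context Ultrametric_space
begin

definition twins :: "'a \<Rightarrow> 'a \<Rightarrow> bool" where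
  "twins x y \<longleftrightarrow> x \<in> M \<and> y \<in> M \<and> x \<noteq> y \<and> (\<forall>z\<in>M - {x, y}. d x z = d y z)"

definition module :: "'a set \<Rightarrow> bool" where
  "module S \<longleftrightarrow> S \<subseteq> M \<and> (\<forall>x\<in>S. \<forall>y\<in>S. \<forall>z\<in>M - S. d x z = d y z)"

lemma twins_transpose_Iso:
  assumes "twins x y"
  shows "restrict (Transposition.transpose x y) M \<in> Iso M d"
proof -
  have xy: "x \<in> M" "y \<in> M" "\<And>z. z \<in> M \<Longrightarrow> z \<noteq> x \<Longrightarrow> z \<noteq> y \<Longrightarrow> d x z = d y z"
    using assms by (auto simp: twins_def)
  then have xy': "\<And>z. z \<in> M \<Longrightarrow> z \<noteq> x \<Longrightarrow> z \<noteq> y \<Longrightarrow> d z x = d z y"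
    by (metis commute)
  have "bij_betw (Transposition.transpose x y) M M"
    using xy by (simp add: bij_betw_def)
  moreover have "d (Transposition.transpose x y u) (Transposition.transpose x y v) = d u v"
    if "u \<in> M" "v \<in> M" for u v
    using that xy(1,2) xy(3)[of v] xy'[of u] commute[of x y] mdist_zero[of x] mdist_zero[of y]
    unfolding Transposition.transpose_def by (smt (verit))
  ultimately show ?thesis
    by (simp add: Iso_def cong: bij_betw_cong)
qed

text \<open>A closest pair of \<open>S\<close> cannot be told apart from inside \<open>S\<close> by
  the strong triangle inequality, nor from outside because \<open>S\<close> is a module. So the pair
  are twins in all of \<open>M\<close>.\<close>

lemma module_contains_twins:
  assumes "module S" "finite S" "u \<in> S" "v \<in> S" "u \<noteq> v"
  obtains x y where "x \<in> S" "y \<in> S" "twins x y"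
proof -
  let ?E = "{(x, y) \<in> S \<times> S. x \<noteq> y}"
  have "?E \<subseteq> S \<times> S" "?E \<noteq> {}"
    using assms by auto
  with \<open>finite S\<close> have "finite ?E" "?E \<noteq> {}"
    by (simp_all add: finite_subset)
  then obtain e where e: "is_arg_min (\<lambda>(x, y). d x y) (\<lambda>e. e \<in> ?E) e"
    using ex_is_arg_min_if_finite by blast
  obtain x y where "e = (x, y)"
    by (cases e)
  with e have xy: "x \<in> S" "y \<in> S" "x \<noteq> y"
    and le: "\<forall>e\<in>?E. d x y \<le> (case e of (u, v) \<Rightarrow> d u v)"
    unfolding is_arg_min_linorder by simp_all
  have min: "d x y \<le> d u v" if "u \<in> S" "v \<in> S" "u \<noteq> v" for u v
    using bspec[OF le, of "(u, v)"] that by simp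
  have S: "S \<subseteq> M" "\<And>x y z. x \<in> S \<Longrightarrow> y \<in> S \<Longrightarrow> z \<in> M \<Longrightarrow> z \<notin> S \<Longrightarrow> d x z = d y z"
    using \<open>module S\<close> unfolding module_def by blast+
  have "d x z = d y z" if z: "z \<in> M" "z \<noteq> x" "z \<noteq> y" for z
  proof (cases "z \<in> S")
    case True
    then show ?thesis
      \<comment> \<open>Minimality gives \<open>d x y \<le> d y z\<close>, hence
        \<open>d x z \<le> max (d x y) (d y z) = d y z\<close>; the reverse inequality is
        symmetric.\<close>
      using ultrametric[of x z y] ultrametric[of y z x] min[of x z] min[of y z] xy z S(1)
        commute[of x y] by (fastforce simp: subset_iff)
  next
    case False
    then show ?thesis
      using S(2) xy z by blast
  qed
  then have "twins x y"
    using xy S(1) by (auto simp: twins_def)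
  with xy that show thesis by blast
qed

lemma disjoint_from_twins_moves_three:
  assumes "finite M" "twins a b" "twins u v" "a \<notin> {u, v}"
  shows "\<exists>g\<in>Iso M d. card (M - Fix M g) \<ge> 3"
proof -
  define g where "g = compose M (restrict (Transposition.transpose a b) M) (restrict (Transposition.transpose u v) M)"
  have "g \<in> Iso M d"
    unfolding g_def using assms by (intro Iso_compose twins_transpose_Iso)
  \<comment> \<open>The inner swap fixes \<open>a\<close>, and the outer one sends it to
    \<open>b\<close>. If \<open>b\<close> is one of \<open>u\<close>, \<open>v\<close>, the swaps
    form a 3-cycle; otherwise they are disjoint.\<close>
  moreover have "{a, u, v} \<subseteq> M - Fix M g"
    using assms(2-)
    by (auto simp: twins_def g_def Fix_def compose_def Transposition.transpose_def split: if_splits)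
  then have "card {a, u, v} \<le> card (M - Fix M g)"
    using \<open>finite M\<close> by (intro card_mono) auto
  moreover have "card {a, u, v} = 3"
    using assms by (auto simp: twins_def)
  ultimately show ?thesis by auto
qed

text \<open>\<open>M\<close> is itself a module with two points, so it contains twins, and swapping
  them moves exactly two points. The minimum of \<open>card (Fix M g)\<close> is thus at most
  \<open>card M - 2\<close>, and only the lower bound remains as a condition.\<close>

lemma class_R_iff:
  assumes "finite M" "card M \<ge> 2"
  shows "(M, d) \<in> class_R \<longleftrightarrow> (\<forall>g\<in>Iso M d. card (M - Fix M g) \<le> 2)"
proof -
  let ?F = "(\<lambda>g. card (Fix M g)) ` Iso M d"
  have moved: "card (M - Fix M g) = card M - card (Fix M g)" "card (Fix M g) \<le> card M" for g
    using \<open>finite M\<close> Fix_subset[of M g]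
    by (simp_all add: card_Diff_subset card_mono finite_subset)
  have fin: "finite ?F"
    using moved(2) by (auto intro: finite_subset[of _ "{..card M}"])
  have ne: "?F \<noteq> {}"
    using Iso_id by blast
  obtain u v where "u \<in> M" "v \<in> M" "u \<noteq> v"
    using assms by (metis card_2_iff' ex_card subset_iff)
  moreover have "module M"
    by (simp add: module_def)
  ultimately obtain x y where xy: "twins x y"
    using \<open>finite M\<close> by (meson module_contains_twins)
  have "M - Fix M (restrict (Transposition.transpose x y) M) = {x, y}"
    using xy by (auto simp: Fix_def twins_def Transposition.transpose_def split: if_splits)
  then have "card M - card (Fix M (restrict (Transposition.transpose x y) M)) = 2"
    using xy moved(1)[of "restrict (Transposition.transpose x y) M"] by (simp add: twins_def)
  then have "\<exists>k\<in>?F. k + 2 = card M"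
    using twins_transpose_Iso[OF xy] by (intro bexI[OF _ imageI]) auto
  then have le: "Min ?F + 2 \<le> card M"
    using Min_le[OF fin] by fastforce
  have "(M, d) \<in> class_R \<longleftrightarrow> int (Min ?F) = int (card M) - 2"
    using \<open>finite M\<close> Ultrametric_space_axioms by (simp add: class_R_def)
  also have "\<dots> \<longleftrightarrow> card M - 2 \<le> Min ?F"
    using le by linarith
  also have "\<dots> \<longleftrightarrow> (\<forall>g\<in>Iso M d. card M - 2 \<le> card (Fix M g))"
    using fin ne by simp
  also have "\<dots> \<longleftrightarrow> (\<forall>g\<in>Iso M d. card (M - Fix M g) \<le> 2)"
    unfolding moved(1) by (intro ball_cong refl) linarith
  finally show ?thesis .
qed

section \<open>Balls of an ultrametric space\<close>

lemma mcball_diameter_le: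
  assumes "x \<in> mcball t r" "y \<in> mcball t r"
  shows "d x y \<le> r"
  using ultrametric[of x y t] assms commute[of x t] by auto

text \<open>A point \<open>z\<close> outside the ball has distance more than \<open>r\<close> to
  each \<open>y\<close> inside, while points inside are at most \<open>r\<close> apart. So
  \<open>d x y\<close> is dominated in the strong triangle inequality.\<close>

lemma module_mcball: "module (mcball t r)"
proof -
  have "d x z \<le> d y z" if "x \<in> mcball t r" "y \<in> mcball t r" "z \<in> M - mcball t r" for x y z
    using mcball_diameter_le[OF that(1,2)] ultrametric[of x z y] ultrametric[of t z y] that by auto
  then show ?thesis
    unfolding module_def by (auto intro!: order.antisym)
qed

section \<open>The two implications between moved points and stars\<close>

lemma star_if_moves_at_most_two:
  assumes "finite M" and le: "\<And>g. g \<in> Iso M d \<Longrightarrow> card (M - Fix M g) \<le> 2"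
    and "B \<in> balls M d" "diam B d > 0"
  shows "is_star (diametrical_graph B d)"
proof -
  obtain t r where B: "B = mcball t r" "t \<in> B"
    using \<open>B \<in> balls M d\<close> by (auto simp: balls_def)
  have BM: "B \<subseteq> M" and "finite B" and "module B"
    using B(1) \<open>finite M\<close> module_mcball mcball_subset_mspace by (auto intro: finite_subset)
  have ge: "d x y \<le> diam B d" if "x \<in> B" "y \<in> B" for x y
    using diam_ge[of B] \<open>finite B\<close> that by blast
  obtain u v where uv: "u \<in> B" "v \<in> B" "d u v = diam B d"
    using diam_attained[of B d] \<open>finite B\<close> B(2) by blast
  have "u \<noteq> v"
    using uv BM \<open>diam B d > 0\<close> by (metis less_irrefl mdist_zero subsetD)
  then obtain a b where ab: "a \<in> B" "b \<in> B" "twins a b"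
    using module_contains_twins[OF \<open>module B\<close> \<open>finite B\<close> uv(1,2)] by blast
  define C where "C = {w \<in> B. d a w = diam B d}"
  have "a \<notin> C"
    using BM ab \<open>diam B d > 0\<close> by (auto simp: C_def)
  \<comment> \<open>Since \<open>d a z\<close> is below the diameter,
    \<open>d a w = diam B d\<close> forces \<open>d w z\<close> up to the diameter.\<close>
  have far: "d w z = diam B d" if "w \<in> C" "z \<in> B - C" for w z
    using that ge[of a z] ge[of w z] ultrametric[of a w z] BM ab(1) commute[of w z]
    by (auto simp: C_def subset_iff)
  \<comment> \<open>Both points are closer to \<open>a\<close> than the diameter, hence also to each
    other.\<close>
  have near: "d y z < diam B d" if "y \<in> B - C" "z \<in> B - C" for y z
    using that ge[of a y] ge[of a z] ultrametric[of y z a] BM ab(1) commute[of y a]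
    by (force simp: C_def subset_iff)
  have "module C"
    unfolding module_def
  proof (intro conjI ballI)
    show "C \<subseteq> M"
      using BM by (auto simp: C_def)
    fix x y z assume *: "x \<in> C" "y \<in> C" "z \<in> M - C"
    show "d x z = d y z"
      \<comment> \<open>Inside \<open>B\<close> both distances equal the diameter by
        \<open>far\<close>; outside \<open>B\<close> they agree because \<open>B\<close> is a
        module.\<close>
      using * far[of x z] far[of y z] \<open>module B\<close> by (cases "z \<in> B") (auto simp: C_def module_def)
  qed
  \<comment> \<open>If \<open>C\<close> were empty, \<open>near\<close> would apply to the
    diametrical pair \<open>u\<close>, \<open>v\<close>.\<close>
  have "C \<noteq> {}"
    using near[of u v] uv by auto
  then obtain p where p: "p \<in> C" by blast
  have "C = {p}"
  proof (rule ccontr)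
    assume "C \<noteq> {p}"
    then obtain q where q: "q \<in> C" "q \<noteq> p"
      using p by blast
    have "finite C"
      using \<open>finite B\<close> by (simp add: C_def)
    then obtain x y where xy: "x \<in> C" "y \<in> C" "twins x y"
      using module_contains_twins[OF \<open>module C\<close> _ q(1) p q(2)] by blast
    then have "a \<notin> {x, y}"
      using \<open>a \<notin> C\<close> by auto
    then obtain g where "g \<in> Iso M d" "card (M - Fix M g) \<ge> 3"
      using disjoint_from_twins_moves_three[OF \<open>finite M\<close> ab(3) xy(3)] by blast
    with le[of g] show False by simp
  qed
  then have "p \<in> B" "B \<noteq> {p}"
    using p ab(1) \<open>a \<notin> C\<close> by (auto simp: C_def)
  moreover have "\<forall>v\<in>B - {p}. d p v = diam B d"
    using far p \<open>C = {p}\<close> by auto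
  moreover have "\<forall>u\<in>B - {p}. \<forall>v\<in>B - {p}. u \<noteq> v \<longrightarrow> d u v \<noteq> diam B d"
    using near \<open>C = {p}\<close> by (metis less_irrefl)
  ultimately show ?thesis
    using is_star_diametrical_graph_iff[of B d] \<open>finite B\<close> commute by blast
qed

lemma moves_at_most_two_if_stars:
  assumes "finite M" and g: "g \<in> Iso M d"
    and star: "\<And>B. B \<in> balls M d \<Longrightarrow> diam B d > 0 \<Longrightarrow> is_star (diametrical_graph B d)"
  shows "card (M - Fix M g) \<le> 2"
proof (cases "M - Fix M g = {}")
  case False
  define N where "N = M - Fix M g"
  have N: "finite N" "N \<noteq> {}" "N \<subseteq> M"
    using \<open>finite M\<close> False by (auto simp: N_def)
  have inj: "inj_on g M" and gM: "\<And>x. x \<in> M \<Longrightarrow> g x \<in> M"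
    and iso: "\<And>x y. x \<in> M \<Longrightarrow> y \<in> M \<Longrightarrow> d (g x) (g y) = d x y"
    using g by (auto simp: Iso_def bij_betw_def)
  \<comment> \<open>If \<open>g x\<close> were fixed, injectivity would turn
    \<open>g (g x) = g x\<close> into \<open>g x = x\<close>.\<close>
  have moved: "g x \<noteq> x" and gN: "g x \<in> N" if "x \<in> N" for x
    using that gM inj by (auto simp: N_def Fix_def dest: inj_onD)
  have fixed: "g x = x" if "x \<in> M" "x \<notin> N" for x
    using that by (auto simp: N_def Fix_def)
  define D where "D = diam N d"
  have D: "d x y \<le> D" if "x \<in> N" "y \<in> N" for x y
    unfolding D_def using diam_ge[OF N(1,2)] that by blast
  obtain u v where uv: "u \<in> N" "v \<in> N" "d u v = D"
    unfolding D_def using diam_attained[OF N(1,2), of d] by blast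
  have "0 < d u (g u)"
    using uv(1) moved[of u] gM N(3) by (metis mdist_pos_less subsetD)
  also have "\<dots> \<le> D"
    using D gN uv(1) by blast
  finally have "D > 0" .
  define B where "B = mcball u D"
  have NB: "N \<subseteq> B"
    using D uv N(3) by (auto simp: B_def)
  have BM: "B \<subseteq> M"
    unfolding B_def by (rule mcball_subset_mspace)
  then have "finite B"
    using \<open>finite M\<close> by (rule finite_subset)
  \<comment> \<open>Moved points stay in \<open>N\<close>, which lies in \<open>B\<close>, and all
    others are fixed.\<close>
  have gB: "g x \<in> B" if "x \<in> B" for x
    using that gN[of x] NB fixed[of x] BM by (cases "x \<in> N") auto
  have "B \<noteq> {}"
    using N NB by blast
  obtain x y where "x \<in> B" "y \<in> B" "d x y = diam B d"
    using diam_attained[OF \<open>finite B\<close> \<open>B \<noteq> {}\<close>, of d] by blast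
  then have "diam B d \<le> D"
    using mcball_diameter_le[of x u D y] by (simp add: B_def)
  moreover have "D \<le> diam B d"
    using diam_ge[OF \<open>finite B\<close> \<open>B \<noteq> {}\<close>] uv NB by (metis subsetD)
  ultimately have diamB: "diam B d = D" by simp
  have "B \<in> balls M d"
    using uv(1) N(3) \<open>D > 0\<close> by (force simp: B_def balls_def)
  then have "is_star (diametrical_graph B d)"
    using star diamB \<open>D > 0\<close> by simp
  then have "\<exists>p\<in>B. B \<noteq> {p} \<and> (\<forall>v\<in>B - {p}. d p v = D) \<and>
      (\<forall>u\<in>B - {p}. \<forall>v\<in>B - {p}. u \<noteq> v \<longrightarrow> d u v \<noteq> D)"
    unfolding is_star_diametrical_graph_iff[OF \<open>finite B\<close> commute] diamB .
  then obtain p where p: "p \<in> B" "\<And>v. v \<in> B - {p} \<Longrightarrow> d p v = D"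
    "\<And>u v. u \<in> B - {p} \<Longrightarrow> v \<in> B - {p} \<Longrightarrow> u \<noteq> v \<Longrightarrow> d u v \<noteq> D"
    by blast
  have "u \<noteq> v"
    using uv \<open>D > 0\<close> N(3) by auto
  \<comment> \<open>\<open>u\<close> and \<open>v\<close> are at distance \<open>D\<close>, which
    two distinct points other than the centre never are.\<close>
  then have "p \<in> {u, v}"
    using p(3)[of u v] uv NB by blast
  then have "p \<in> N"
    using uv by blast
  \<comment> \<open>Otherwise \<open>g p\<close> and \<open>g w\<close> would be distinct points of
    \<open>B\<close> other than \<open>p\<close> at distance \<open>D\<close>.\<close>
  have to_p: "g w = p" if w: "w \<in> B - {p}" for w
  proof (rule ccontr)
    assume "g w \<noteq> p"
    moreover have "d (g p) (g w) = D"
      using iso[of p w] p(1,2) w BM by auto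
    moreover have "g p \<noteq> g w"
      using inj_onD[OF inj, of p w] w p(1) BM by blast
    ultimately show False
      using p(3)[of "g p" "g w"] moved[OF \<open>p \<in> N\<close>] gB w p(1) by blast
  qed
  \<comment> \<open>The injective \<open>g\<close> maps \<open>B - {p}\<close> into a single
    point.\<close>
  have "card (B - {p}) \<le> card {p}"
  proof (rule card_inj_on_le)
    show "inj_on g (B - {p})"
      using inj_on_subset[OF inj] BM by blast
  qed (use to_p in auto)
  then have "card B \<le> 2"
    using p(1) \<open>finite B\<close> by (simp add: card_Diff_singleton)
  then show ?thesis
    using card_mono[OF \<open>finite B\<close> NB] by (simp add: N_def)
next
  case True
  show ?thesis
    unfolding True by simp
qed

end

theorem proposition4p1:
  fixes X :: "'a set" and d :: "'a \<Rightarrow> 'a \<Rightarrow> real"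
  assumes "Ultrametric_space X d" and "finite X" and "card X \<ge> 2"
  shows "(X, d) \<in> class_R \<longleftrightarrow>
    (\<forall>B \<in> balls X d. diam B d > 0 \<longrightarrow> is_star (diametrical_graph B d))"
proof -
  interpret Ultrametric_space X d by fact
  show ?thesis
    using class_R_iff star_if_moves_at_most_two moves_at_most_two_if_stars assms(2,3) by blast
qed

end
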